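(* Let $\nu\in\mathcal P_2(\mathbb R^d)$ and $\sigma>0$ be fixed. Then there is a constant $C_d>0$ depending only on $d$ such that, for every $\mu\in\mathcal P_2(\mathbb R^d)$, $$\Big|\mathcal H\big[SW_2^\sigma(\mu,\nu)\big]^2\Big|\le C_d,$$ where $\mathcal H$ acts on the map $\mu\mapsto[SW_2^\sigma(\mu,\nu)]^2$.
   Context: $\mathcal P_2(\mathbb R^d)$ is the space of probability measures on $\mathbb R^d$ with finite second moment; $\mathcal W_2$ is the 2-Wasserstein distance. **Operator $\mathcal H$.** For $u:\mathcal P_2(\mathbb R^d)\to\mathbb R$, $\mathcal H u(\mu):=\frac{d^2}{dw^2}u((I_d+w)_\sharp\mu)\big|_{w=0}\in\mathbb R^{d\times d}$ (Hessian in $w\in\mathbb R^d$), where $(I_d+w)_\sharp\mu$ is the pushforward of $\mu$ by $x\mapsto x+w$. $|\cdot|$ is the Frobenius norm. **Gaussian regularized sliced Wasserstein distance.** $\mathcal S^{d-1}=\{x\in\mathbb R^d:|x|=1\}$ with its standard spherical measure $d\theta$. For $\theta\in\mathcal S^{d-1}$, $\mu_\theta\in\mathcal P_2(\mathbb R)$ is the pushforward of $\mu$ by $x\mapsto\theta^\top x$. $SW_2(\mu,\nu):=\{\int_{\mathcal S^{d-1}}[\mathcal W_2(\mu_\theta,\nu_\theta)]^2d\theta\}^{1/2}$ and $SW_2^\sigma(\mu,\nu):=SW_2(\mu^\sigma,\nu^\sigma)$, where $\mu^\sigma:=\mu*\mathcal N_\sigma$ and $\mathcal N_\sigma$ is the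 centered normal law on $\mathbb R^d$ with covariance $\sigma^2I_d$. *)

theory Defs
  imports "HOL-Probability.Probability"
begin

section \<open>Probability measures and the 2-Wasserstein distance\<close>

definition P2 :: "'a::euclidean_space measure set" where
  "P2 = {\<mu>. prob_space \<mu> \<and> sets \<mu> = sets borel \<and> integrable \<mu> (\<lambda>x. (norm x)\<^sup>2)}"

definition couplings ::
    "'a::euclidean_space measure \<Rightarrow> 'a measure \<Rightarrow> ('a \<times> 'a) measure set" where
  "couplings \<mu> \<nu> = {\<pi>. prob_space \<pi> \<and> sets \<pi> = sets (borel \<Otimes>\<^sub>M borel) \<and>
     distr \<pi> borel fst = \<mu> \<and> distr \<pi> borel snd = \<nu>}"

text \<open>The infimum is taken in the extended nonnegative reals; it is finite on \<open>P2\<close>, so the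
  conversion to a real number loses nothing there.\<close>

definition wasserstein2 :: "'a::euclidean_space measure \<Rightarrow> 'a measure \<Rightarrow> real" where
  "wasserstein2 \<mu> \<nu> =
     sqrt (enn2real (INF \<pi>\<in>couplings \<mu> \<nu>. \<integral>\<^sup>+ (x, y). ennreal ((dist x y)\<^sup>2) \<partial>\<pi>))"


section \<open>The spherical measure\<close>

text \<open>The (unnormalised) surface measure of the unit sphere, defined through polar coordinates:
  a Borel set \<open>A\<close> of directions has measure \<open>d \<cdot> \<lambda> {x. 0 < |x| < 1 \<and> x / |x| \<in> A}\<close>.
  In dimension one this is the counting measure on the two points \<open>\<plusminus>1\<close>.\<close>

definition sphere_measure :: "'a::euclidean_space measure" where
  "sphere_measure = scale_measure (of_nat DIM('a))
     (distr (restrict_space lborel (ball 0 1 - {0})) (restrict_space borel (sphere 0 1))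
        (\<lambda>x. x /\<^sub>R norm x))"


section \<open>The Gaussian regularised sliced Wasserstein distance\<close>

definition proj_measure :: "'a::euclidean_space measure \<Rightarrow> 'a \<Rightarrow> real measure" where
  "proj_measure \<mu> \<theta> = distr \<mu> borel (\<lambda>x. \<theta> \<bullet> x)"

definition SW2 :: "'a::euclidean_space measure \<Rightarrow> 'a measure \<Rightarrow> real" where
  "SW2 \<mu> \<nu> =
     sqrt (LINT \<theta>|sphere_measure. (wasserstein2 (proj_measure \<mu> \<theta>) (proj_measure \<nu> \<theta>))\<^sup>2)"

text \<open>The law with independent centred coordinates of variance \<open>\<sigma>\<^sup>2\<close>; the second
  argument of \<open>normal_density\<close> is the standard deviation.\<close>

definition gaussian :: "real \<Rightarrow> 'a::euclidean_space measure" where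
  "gaussian \<sigma> = density lborel (\<lambda>x. ennreal (\<Prod>b\<in>Basis. normal_density 0 \<sigma> (x \<bullet> b)))"

definition SW2_reg :: "real \<Rightarrow> 'a::ordered_euclidean_space measure \<Rightarrow> 'a measure \<Rightarrow> real" where
  "SW2_reg \<sigma> \<mu> \<nu> = SW2 (\<mu> \<star> gaussian \<sigma>) (\<nu> \<star> gaussian \<sigma>)"


section \<open>Hessians and the operator \<open>\<H>\<close>\<close>

text \<open>\<open>f\<close> is differentiable near \<open>x\<close> and its gradient is differentiable at \<open>x\<close> with
  Jacobian matrix \<open>A\<close>.\<close>

definition has_hessian ::
    "((real ^ 'n) \<Rightarrow> real) \<Rightarrow> real ^ 'n ^ 'n \<Rightarrow> real ^ 'n \<Rightarrow> bool" where
  "has_hessian f A x \<longleftrightarrow>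
     (\<exists>G. (\<forall>\<^sub>F y in nhds x. GDERIV f y :> G y) \<and> (G has_derivative (\<lambda>h. A *v h)) (at x))"

definition twice_differentiable_at :: "((real ^ 'n) \<Rightarrow> real) \<Rightarrow> real ^ 'n \<Rightarrow> bool" where
  "twice_differentiable_at f x \<longleftrightarrow> (\<exists>A. has_hessian f A x)"

definition hessian :: "((real ^ 'n) \<Rightarrow> real) \<Rightarrow> real ^ 'n \<Rightarrow> real ^ 'n ^ 'n" where
  "hessian f x = (THE A. has_hessian f A x)"

lemma has_hessian_unique:
  assumes "has_hessian f A x" "has_hessian f B x"
  shows "A = B"
proof -
  obtain G where G: "\<forall>\<^sub>F y in nhds x. GDERIV f y :> G y" "(G has_derivative (\<lambda>h. A *v h)) (at x)"
    using assms(1) by (auto simp: has_hessian_def)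
  obtain H where H: "\<forall>\<^sub>F y in nhds x. GDERIV f y :> H y" "(H has_derivative (\<lambda>h. B *v h)) (at x)"
    using assms(2) by (auto simp: has_hessian_def)
  have eq: "\<forall>\<^sub>F y in nhds x. G y = H y"
    using G(1) H(1)
  proof eventually_elim
    case (elim y)
    then have "(\<lambda>h. h \<bullet> G y) = (\<lambda>h. h \<bullet> H y)"
      unfolding gderiv_def by (rule has_derivative_unique)
    then show ?case
      by (metis vector_eq_rdot inner_commute)
  qed
  have "\<forall>\<^sub>F y in at x. G y = H y"
    using eq by (simp add: eventually_at_filter eventually_mono)
  then have "(H has_derivative (\<lambda>h. A *v h)) (at x)"
    by (rule has_derivative_transform_eventually[OF G(2)])
       (simp_all add: eventually_nhds_x_imp_x[OF eq])
  then have "(\<lambda>h. A *v h) = (\<lambda>h. B *v h)"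
    using H(2) by (rule has_derivative_unique)
  then show "A = B"
    by (simp add: matrix_eq fun_eq_iff)
qed

lemma hessian_eq: "has_hessian f A x \<Longrightarrow> hessian f x = A"
  unfolding hessian_def by (blast intro: has_hessian_unique)

definition translate :: "'a::euclidean_space \<Rightarrow> 'a measure \<Rightarrow> 'a measure" where
  "translate w \<mu> = distr \<mu> borel (\<lambda>x. x + w)"

definition calH_exists :: "((real ^ 'n) measure \<Rightarrow> real) \<Rightarrow> (real ^ 'n) measure \<Rightarrow> bool" where
  "calH_exists u \<mu> \<longleftrightarrow> twice_differentiable_at (\<lambda>w. u (translate w \<mu>)) 0"

definition calH :: "((real ^ 'n) measure \<Rightarrow> real) \<Rightarrow> (real ^ 'n) measure \<Rightarrow> real ^ 'n ^ 'n" where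
  "calH u \<mu> = hessian (\<lambda>w. u (translate w \<mu>)) 0"

text \<open>The norm of the type \<open>real ^ 'n ^ 'n\<close> is the Frobenius norm.\<close>

lemma norm_matrix_eq_frobenius:
  fixes A :: "real ^ 'n ^ 'm"
  shows "norm A = sqrt (\<Sum>i\<in>UNIV. \<Sum>j\<in>UNIV. (A $ i $ j)\<^sup>2)"
  by (simp add: norm_vec_def L2_set_def sum_nonneg)

lemma emeasure_sphere_measure:
  fixes A :: "'a::euclidean_space set"
  assumes "A \<in> sets borel" "A \<subseteq> sphere 0 1"
  shows "emeasure sphere_measure A =
    of_nat DIM('a) * emeasure lborel {x. 0 < norm x \<and> norm x < 1 \<and> x /\<^sub>R norm x \<in> A}"
proof -
  have [measurable]: "(\<lambda>x::'a. x /\<^sub>R norm x) \<in> borel \<rightarrow>\<^sub>M borel"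
    by measurable
  have m: "(\<lambda>x::'a. x /\<^sub>R norm x) \<in>
      restrict_space lborel (ball 0 1 - {0}) \<rightarrow>\<^sub>M restrict_space borel (sphere 0 1)"
    by (intro measurable_restrict_space2)
       (auto simp: space_restrict_space intro!: measurable_restrict_space1)
  have A: "A \<in> sets (restrict_space borel (sphere 0 1))"
    using assms by (subst sets_restrict_space_iff) auto
  have "(\<lambda>x. x /\<^sub>R norm x) -` A \<inter> space (restrict_space lborel (ball 0 1 - {0})) =
      {x. 0 < norm x \<and> norm x < 1 \<and> x /\<^sub>R norm x \<in> A}"
    by (auto simp: space_restrict_space)
  then show ?thesis
    unfolding sphere_measure_def emeasure_scale_measure emeasure_distr[OF m A]
    by (subst emeasure_restrict_space) (auto simp: space_restrict_space)
qed

end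

(* For probability measures on the line, translating the first one by a changes the squared
   Wasserstein distance by 2 a (difference of the means) + a^2: shifting the first component maps
   couplings to couplings. Translation commutes with the convolution and with the projections
   (where w becomes \<theta> \<bullet> w), so w \<mapsto> SW_2^\<sigma>((I + w)_# \<mu>, \<nu>)^2 is an affine function plus
   the quadratic form \<integral> (\<theta> \<bullet> w)^2 d\<theta>, whose Hessian is the same for all \<mu>, \<nu> and \<sigma>. *)

theory Submission
  imports Defs
begin

section \<open>Square-integrable measures and their couplings\<close>

lemma P2D:
  fixes \<mu> :: "'a::euclidean_space measure"
  assumes "\<mu> \<in> P2"
  shows "prob_space \<mu>" "sets \<mu> = sets borel" "space \<mu> = UNIV"
    "integrable \<mu> (\<lambda>x. (norm x)\<^sup>2)" "integrable \<mu> (\<lambda>x. x)"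
proof -
  show p: "prob_space \<mu>" and s: "sets \<mu> = sets borel" and i: "integrable \<mu> (\<lambda>x. (norm x)\<^sup>2)"
    using assms by (auto simp: P2_def)
  show "space \<mu> = UNIV" using sets_eq_imp_space_eq[OF s] by simp
  interpret prob_space \<mu> by fact
  \<comment> \<open>The mean exists because 1 + |x|^2 dominates |x|: from 2|x| \<le> |x|^2 + 1 and 0
    \<le> |x|. Constants are integrable as \<mu> has mass 1.\<close>
  have "integrable \<mu> (\<lambda>x. 1 + (norm x)\<^sup>2)" using i by simp
  then show "integrable \<mu> (\<lambda>x. x)"
  proof (rule Bochner_Integration.integrable_bound)
    show "(\<lambda>x. x) \<in> borel_measurable \<mu>" using s by (simp add: measurable_ident_sets)
    have "norm x \<le> 1 + (norm x)\<^sup>2" for x :: 'a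
      using sum_squares_bound[of "norm x" 1] norm_ge_zero[of x]
      unfolding power_one mult_1_right by linarith
    then show "AE x in \<mu>. norm x \<le> norm (1 + (norm x)\<^sup>2)" by simp
  qed
qed

lemma couplings_D:
  fixes \<mu> \<nu> :: "'a::euclidean_space measure"
  assumes "\<pi> \<in> couplings \<mu> \<nu>"
  shows "prob_space \<pi>" "sets \<pi> = sets (borel \<Otimes>\<^sub>M borel)"
    "distr \<pi> borel fst = \<mu>" "distr \<pi> borel snd = \<nu>"
    "fst \<in> \<pi> \<rightarrow>\<^sub>M borel" "snd \<in> \<pi> \<rightarrow>\<^sub>M borel"
proof -
  show "prob_space \<pi>" and s: "sets \<pi> = sets (borel \<Otimes>\<^sub>M borel)"
    and "distr \<pi> borel fst = \<mu>" "distr \<pi> borel snd = \<nu>"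
    using assms by (auto simp: couplings_def)
  show "fst \<in> \<pi> \<rightarrow>\<^sub>M borel" "snd \<in> \<pi> \<rightarrow>\<^sub>M borel"
    unfolding measurable_cong_sets[OF s refl] by measurable
qed

text \<open>Change of variables along the two projections. It is what makes the mean of a coordinate
  the same for all couplings.\<close>

lemma couplings_marginals:
  fixes \<mu> \<nu> :: "'a::euclidean_space measure" and f :: "'a \<Rightarrow> 'b::{banach, second_countable_topology}"
  assumes "\<pi> \<in> couplings \<mu> \<nu>" and [measurable]: "f \<in> borel_measurable borel"
  shows "integrable \<pi> (\<lambda>z. f (fst z)) \<longleftrightarrow> integrable \<mu> f"
    "integrable \<pi> (\<lambda>z. f (snd z)) \<longleftrightarrow> integrable \<nu> f"
    "(LINT z|\<pi>. f (fst z)) = (LINT x|\<mu>. f x)"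
    "(LINT z|\<pi>. f (snd z)) = (LINT x|\<nu>. f x)"
proof -
  note c = couplings_D[OF assms(1)]
  note [measurable] = c(5,6)
  show "integrable \<pi> (\<lambda>z. f (fst z)) \<longleftrightarrow> integrable \<mu> f"
    using integrable_distr_eq[of fst \<pi> borel f] by (simp add: c)
  show "integrable \<pi> (\<lambda>z. f (snd z)) \<longleftrightarrow> integrable \<nu> f"
    using integrable_distr_eq[of snd \<pi> borel f] by (simp add: c)
  show "(LINT z|\<pi>. f (fst z)) = (LINT x|\<mu>. f x)"
    using integral_distr[of fst \<pi> borel f] by (simp add: c)
  show "(LINT z|\<pi>. f (snd z)) = (LINT x|\<nu>. f x)"
    using integral_distr[of snd \<pi> borel f] by (simp add: c)
qed

text \<open>Serves twice: as a witness that the infimum over couplings is finite, and as the joint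
  law whose sum of coordinates has the convolution as its law.\<close>

lemma pair_measure_coupling:
  fixes \<mu> \<nu> :: "'a::euclidean_space measure"
  assumes "\<mu> \<in> P2" "\<nu> \<in> P2"
  shows "\<mu> \<Otimes>\<^sub>M \<nu> \<in> couplings \<mu> \<nu>"
proof -
  interpret \<mu>: prob_space \<mu> using assms by (simp add: P2D)
  interpret \<nu>: prob_space \<nu> using assms by (simp add: P2D)
  interpret pair_prob_space \<mu> \<nu> ..
  note s[measurable_cong] = P2D(2)[OF assms(1)] P2D(2)[OF assms(2)]
  have "distr (\<mu> \<Otimes>\<^sub>M \<nu>) borel fst = distr (\<mu> \<Otimes>\<^sub>M \<nu>) \<mu> fst"
    by (rule distr_cong) (simp_all add: s)
  also have "\<dots> = \<mu>"
    by (rule \<nu>.distr_pair_fst)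
  finally have 1: "distr (\<mu> \<Otimes>\<^sub>M \<nu>) borel fst = \<mu>" .
  have "distr (\<mu> \<Otimes>\<^sub>M \<nu>) borel snd = \<nu>"
  proof (rule measure_eqI)
    fix A assume "A \<in> sets (distr (\<mu> \<Otimes>\<^sub>M \<nu>) borel snd)"
    then have A: "A \<in> sets borel" by simp
    have "snd -` A \<inter> space (\<mu> \<Otimes>\<^sub>M \<nu>) = space \<mu> \<times> A"
      by (auto simp: space_pair_measure P2D(3)[OF assms(1)] P2D(3)[OF assms(2)])
    then show "emeasure (distr (\<mu> \<Otimes>\<^sub>M \<nu>) borel snd) A = emeasure \<nu> A"
      using A \<nu>.emeasure_pair_measure_Times[OF sets.top, of A \<mu>]
      by (subst emeasure_distr) (simp_all add: s \<mu>.emeasure_space_1)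
  qed (simp add: s)
  with 1 show ?thesis
    unfolding couplings_def by (auto simp: s prob_space_axioms intro!: sets_pair_measure_cong)
qed

text \<open>By the parallelogram law, 2|x|^2 + 2c^2|y|^2 exceeds |x + cy|^2 by exactly |x - cy|^2.
  The factor c covers both the transport cost (c = -1) and the second moment of a convolution (c =
  1).\<close>

lemma couplings_integrable_add:
  fixes \<mu> \<nu> :: "'a::euclidean_space measure"
  assumes "\<mu> \<in> P2" "\<nu> \<in> P2" "\<pi> \<in> couplings \<mu> \<nu>"
  shows "integrable \<pi> (\<lambda>z. (norm (fst z + c *\<^sub>R snd z))\<^sup>2)"
proof -
  note [measurable] = couplings_D(5,6)[OF assms(3)]
  have "integrable \<pi> (\<lambda>z. 2 * (norm (fst z))\<^sup>2 + 2 * c\<^sup>2 * (norm (snd z))\<^sup>2)"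
    using couplings_marginals(1,2)[OF assms(3), of "\<lambda>x. (norm x)\<^sup>2"] P2D(4)[OF assms(1)] P2D(4)[OF assms(2)]
    by auto
  then show ?thesis
  proof (rule Bochner_Integration.integrable_bound)
    have "(norm (x + c *\<^sub>R y))\<^sup>2 \<le> 2 * (norm x)\<^sup>2 + 2 * c\<^sup>2 * (norm y)\<^sup>2" for x y :: 'a
      using zero_le_power2[of "norm (x - c *\<^sub>R y)"]
      unfolding power2_norm_eq_inner by (simp add: algebra_simps inner_commute power2_eq_square)
    then show "AE z in \<pi>. norm ((norm (fst z + c *\<^sub>R snd z))\<^sup>2)
        \<le> norm (2 * (norm (fst z))\<^sup>2 + 2 * c\<^sup>2 * (norm (snd z))\<^sup>2)"
      by simp
  qed measurable
qed

text \<open>Every coupling of square-integrable measures has finite cost, so the extended integral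
  in \<open>wasserstein2\<close> may be traded for a Bochner integral, in which terms of either sign
  can be separated.\<close>

lemma nn_cost_eq_integral:
  fixes \<mu> \<nu> :: "'a::euclidean_space measure"
  assumes "\<mu> \<in> P2" "\<nu> \<in> P2" "\<pi> \<in> couplings \<mu> \<nu>"
  shows "(\<integral>\<^sup>+ (x, y). ennreal ((dist x y)\<^sup>2) \<partial>\<pi>) = ennreal (LINT z|\<pi>. (dist (fst z) (snd z))\<^sup>2)"
    "integrable \<pi> (\<lambda>z. (dist (fst z) (snd z))\<^sup>2)"
proof -
  show i: "integrable \<pi> (\<lambda>z. (dist (fst z) (snd z))\<^sup>2)"
    using couplings_integrable_add[OF assms, of "-1"] by (simp add: dist_norm)
  show "(\<integral>\<^sup>+ (x, y). ennreal ((dist x y)\<^sup>2) \<partial>\<pi>) = ennreal (LINT z|\<pi>. (dist (fst z) (snd z))\<^sup>2)"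
    using nn_integral_eq_integral[OF i] by (simp add: case_prod_unfold)
qed

section \<open>The squared Wasserstein distance as an infimum of real costs\<close>

lemma wasserstein2_sq_le:
  fixes \<mu> \<nu> :: "'a::euclidean_space measure"
  assumes "\<mu> \<in> P2" "\<nu> \<in> P2" "\<pi> \<in> couplings \<mu> \<nu>"
  shows "(wasserstein2 \<mu> \<nu>)\<^sup>2 \<le> (LINT z|\<pi>. (dist (fst z) (snd z))\<^sup>2)"
proof -
  have "(INF \<pi>\<in>couplings \<mu> \<nu>. \<integral>\<^sup>+ (x, y). ennreal ((dist x y)\<^sup>2) \<partial>\<pi>)
      \<le> ennreal (LINT z|\<pi>. (dist (fst z) (snd z))\<^sup>2)"
    unfolding nn_cost_eq_integral(1)[OF assms, symmetric] by (rule INF_lower[OF assms(3)])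
  then show ?thesis
    unfolding wasserstein2_def by (simp add: enn2real_leI)
qed

text \<open>Together with \<open>wasserstein2_sq_le\<close> this makes the squared distance the
  greatest lower bound of the costs. Since \<open>enn2real\<close> sends \<open>\<top>\<close> to 0,
  the infimum has to be shown finite first; the product coupling does that.\<close>

lemma wasserstein2_sq_greatest:
  fixes \<mu> \<nu> :: "'a::euclidean_space measure"
  assumes "\<mu> \<in> P2" "\<nu> \<in> P2"
    and K: "\<And>\<pi>. \<pi> \<in> couplings \<mu> \<nu> \<Longrightarrow> K \<le> (LINT z|\<pi>. (dist (fst z) (snd z))\<^sup>2)"
  shows "K \<le> (wasserstein2 \<mu> \<nu>)\<^sup>2"
proof -
  let ?I = "INF \<pi>\<in>couplings \<mu> \<nu>. \<integral>\<^sup>+ (x, y). ennreal ((dist x y)\<^sup>2) \<partial>\<pi>"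
  have "?I \<le> (\<integral>\<^sup>+ (x, y). ennreal ((dist x y)\<^sup>2) \<partial>(\<mu> \<Otimes>\<^sub>M \<nu>))"
    by (rule INF_lower[OF pair_measure_coupling[OF assms(1,2)]])
  also have "\<dots> < \<top>"
    by (simp add: nn_cost_eq_integral[OF assms(1,2) pair_measure_coupling[OF assms(1,2)]])
  finally have fin: "?I < \<top>" .
  have "ennreal K \<le> ?I"
    by (rule INF_greatest) (simp add: nn_cost_eq_integral(1)[OF assms(1,2)] K ennreal_leI)
  then have "enn2real (ennreal K) \<le> enn2real ?I"
    using fin by (rule enn2real_mono)
  \<comment> \<open>Only an inequality: a negative K is truncated to 0 by
    \<open>ennreal\<close>.\<close>
  moreover have "K \<le> enn2real (ennreal K)"
    by (cases "K \<ge> 0") (auto simp: ennreal_neg)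
  ultimately show ?thesis
    unfolding wasserstein2_def by simp
qed

section \<open>Effect of a translation on the Wasserstein distance\<close>

lemma translate_P2:
  assumes "\<mu> \<in> P2"
  shows "translate a \<mu> \<in> P2"
proof -
  note s[measurable_cong] = P2D(2)[OF assms]
  interpret prob_space \<mu> using assms by (rule P2D)
  have "integrable \<mu> (\<lambda>x. (norm x)\<^sup>2 + 2 * (x \<bullet> a) + (norm a)\<^sup>2)"
    using P2D(4,5)[OF assms] by simp
  also have "(\<lambda>x. (norm x)\<^sup>2 + 2 * (x \<bullet> a) + (norm a)\<^sup>2) = (\<lambda>x. (norm (x + a))\<^sup>2)"
    by (simp add: fun_eq_iff power2_norm_eq_inner algebra_simps inner_commute)
  finally have "integrable (translate a \<mu>) (\<lambda>x. (norm x)\<^sup>2)"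
    unfolding translate_def by (subst integrable_distr_eq) simp_all
  then show ?thesis
    by (auto simp: P2_def translate_def intro!: prob_space_distr)
qed

lemma integral_translate:
  fixes \<mu> :: "'a::euclidean_space measure"
  assumes "\<mu> \<in> P2"
  shows "(LINT x|translate a \<mu>. x) = (LINT x|\<mu>. x) + a"
proof -
  note s[measurable_cong] = P2D(2)[OF assms]
  interpret prob_space \<mu> using assms by (rule P2D)
  have "(LINT x|translate a \<mu>. x) = (LINT x|\<mu>. x + a)"
    unfolding translate_def by (rule integral_distr) simp_all
  also have "\<dots> = (LINT x|\<mu>. x) + (LINT x|\<mu>. a)"
    using P2D(5)[OF assms] by (intro Bochner_Integration.integral_add) simp_all
  finally show ?thesis by (simp add: prob_space)
qed

text \<open>Shifting the first coordinate of a coupling by a adds 2a \<bullet> (x - y) + |a|^2 to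
  the cost integrand. The integral of this depends on the marginals only, so every coupling pays the
  same extra amount and the bound survives the infimum.\<close>

lemma wasserstein2_translate_le:
  fixes \<mu> \<nu> :: "'a::euclidean_space measure"
  assumes "\<mu> \<in> P2" "\<nu> \<in> P2"
  shows "(wasserstein2 (translate a \<mu>) \<nu>)\<^sup>2
    \<le> (wasserstein2 \<mu> \<nu>)\<^sup>2 + 2 * (a \<bullet> ((LINT x|\<mu>. x) - (LINT x|\<nu>. x))) + (norm a)\<^sup>2"
proof -
  let ?m = "2 * (a \<bullet> ((LINT x|\<mu>. x) - (LINT x|\<nu>. x))) + (norm a)\<^sup>2"
  \<comment> \<open>The extra cost \<open>?m\<close> stands on the left so that the whole left side
    is a lower bound independent of \<pi>, as \<open>wasserstein2_sq_greatest\<close>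
    requires.\<close>
  have "(wasserstein2 (translate a \<mu>) \<nu>)\<^sup>2 - ?m \<le> (LINT z|\<pi>. (dist (fst z) (snd z))\<^sup>2)"
    if \<pi>: "\<pi> \<in> couplings \<mu> \<nu>" for \<pi>
  proof -
    note c = couplings_D[OF \<pi>]
    note [measurable] = c(5,6)
    interpret prob_space \<pi> by (rule c)
    note cost = nn_cost_eq_integral(2)[OF assms \<pi>]
    have i: "integrable \<pi> (\<lambda>z. fst z)" "integrable \<pi> (\<lambda>z. snd z)"
      by (rule iffD2[OF couplings_marginals(1)[OF \<pi> measurable_ident_sets[OF refl]] P2D(5)[OF assms(1)]]
          iffD2[OF couplings_marginals(2)[OF \<pi> measurable_ident_sets[OF refl]] P2D(5)[OF assms(2)]])+
    let ?T = "\<lambda>z::'a \<times> 'a. (fst z + a, snd z)"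
    let ?\<rho> = "distr \<pi> (borel \<Otimes>\<^sub>M borel) ?T"
    have "distr ?\<rho> borel fst = translate a \<mu>" "distr ?\<rho> borel snd = \<nu>"
      unfolding translate_def c(3)[symmetric]
      by (simp_all add: distr_distr comp_def c(4))
    then have "?\<rho> \<in> couplings (translate a \<mu>) \<nu>"
      by (auto simp: couplings_def intro!: prob_space_distr)
    then have "(wasserstein2 (translate a \<mu>) \<nu>)\<^sup>2 \<le> (LINT z|?\<rho>. (dist (fst z) (snd z))\<^sup>2)"
      by (rule wasserstein2_sq_le[OF translate_P2[OF assms(1)] assms(2)])
    also have "\<dots> = (LINT z|\<pi>. (dist (fst z + a) (snd z))\<^sup>2)"
      by (subst integral_distr) simp_all
    also have "\<dots> = (LINT z|\<pi>. (dist (fst z) (snd z))\<^sup>2 + 2 * (a \<bullet> (fst z - snd z)) + (norm a)\<^sup>2)"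
      by (intro Bochner_Integration.integral_cong)
        (simp_all add: dist_norm power2_norm_eq_inner algebra_simps inner_commute)
    also have "\<dots> = (LINT z|\<pi>. (dist (fst z) (snd z))\<^sup>2)
        + (LINT z|\<pi>. 2 * (a \<bullet> (fst z - snd z))) + (LINT z|\<pi>. (norm a)\<^sup>2)"
      using cost i by simp
    also have "(LINT z|\<pi>. 2 * (a \<bullet> (fst z - snd z))) = 2 * (a \<bullet> (LINT z|\<pi>. fst z - snd z))"
      using i by simp
    also have "(LINT z|\<pi>. fst z - snd z) = (LINT z|\<pi>. fst z) - (LINT z|\<pi>. snd z)"
      using i by (rule Bochner_Integration.integral_diff)
    also have "(LINT z|\<pi>. fst z) = (LINT x|\<mu>. x)"
      by (rule couplings_marginals(3)[OF \<pi>]) simp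
    also have "(LINT z|\<pi>. snd z) = (LINT x|\<nu>. x)"
      by (rule couplings_marginals(4)[OF \<pi>]) simp
    also have "(LINT z|\<pi>. (norm a)\<^sup>2) = (norm a)\<^sup>2"
      by (simp add: prob_space)
    finally show ?thesis by simp
  qed
  from wasserstein2_sq_greatest[OF assms this] show ?thesis by simp
qed

lemma translate_translate:
  fixes \<mu> :: "'a::euclidean_space measure"
  assumes "sets \<mu> = sets borel"
  shows "translate a (translate b \<mu>) = translate (b + a) \<mu>"
  unfolding translate_def
  by (subst distr_distr) (simp_all add: measurable_cong_sets[OF assms refl] comp_def add.assoc)

lemma translate_0:
  fixes \<mu> :: "'a::euclidean_space measure"
  assumes "sets \<mu> = sets borel"
  shows "translate 0 \<mu> = \<mu>"
  unfolding translate_def using distr_id2[OF assms[symmetric]] by simp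

text \<open>The reverse inequality is the same bound for the translated measure, shifted back by -a.
  Its mean has moved by a, so the quadratic terms there add up to -2|a|^2 + |a|^2 = -|a|^2.\<close>

lemma wasserstein2_translate:
  fixes \<mu> \<nu> :: "'a::euclidean_space measure"
  assumes "\<mu> \<in> P2" "\<nu> \<in> P2"
  shows "(wasserstein2 (translate a \<mu>) \<nu>)\<^sup>2
    = (wasserstein2 \<mu> \<nu>)\<^sup>2 + 2 * (a \<bullet> ((LINT x|\<mu>. x) - (LINT x|\<nu>. x))) + (norm a)\<^sup>2"
proof (rule antisym[OF wasserstein2_translate_le[OF assms]])
  show "(wasserstein2 \<mu> \<nu>)\<^sup>2 + 2 * (a \<bullet> ((LINT x|\<mu>. x) - (LINT x|\<nu>. x))) + (norm a)\<^sup>2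
      \<le> (wasserstein2 (translate a \<mu>) \<nu>)\<^sup>2"
    using wasserstein2_translate_le[OF translate_P2[OF assms(1), of a] assms(2), of "-a"]
    by (simp add: translate_translate[OF P2D(2)[OF assms(1)]] translate_0[OF P2D(2)[OF assms(1)]]
        integral_translate[OF assms(1)] power2_norm_eq_inner algebra_simps)
qed

section \<open>Gaussian smoothing and one-dimensional projections\<close>

lemma gaussian_P2:
  assumes "\<sigma> > 0"
  shows "(gaussian \<sigma> :: 'a::euclidean_space measure) \<in> P2"
proof -
  let ?n = "\<lambda>x::'a. \<Prod>b\<in>Basis. normal_density 0 \<sigma> (x \<bullet> b)"
  \<comment> \<open>The factor in coordinate c of the density weighted by (x \<bullet> b)^2: the
    weight sits in coordinate b alone. Mass and second moments thus both split into one-dimensional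
    integrals.\<close>
  let ?f = "\<lambda>b c t. ennreal (normal_density 0 \<sigma> t * (if c = b then t\<^sup>2 else 1))"
  have prob: "(\<integral>\<^sup>+t. ennreal (normal_density 0 \<sigma> t) \<partial>lborel) = 1"
    using nn_integral_eq_integral[OF integrable_normal_density[OF assms, of 0]] assms by simp
  have "emeasure (gaussian \<sigma> :: 'a measure) UNIV
      = (\<integral>\<^sup>+x. (\<Prod>b\<in>Basis. ennreal (normal_density 0 \<sigma> (x \<bullet> b))) \<partial>(lborel :: 'a measure))"
    unfolding gaussian_def by (subst emeasure_density) (auto simp: prod_ennreal)
  also have "\<dots> = 1"
    by (subst nn_integral_lborel_prod) (simp_all add: prob)
  finally have ps: "prob_space (gaussian \<sigma> :: 'a measure)"
    by (intro prob_spaceI) (simp add: gaussian_def)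
  have "integrable lborel (\<lambda>x. ?n x * (x \<bullet> b)\<^sup>2)" if b: "b \<in> Basis" for b
  proof (rule integrableI_nonneg)
    have fin: "(\<integral>\<^sup>+t. ?f b c t \<partial>lborel) < \<infinity>" for c
      using integrable_normal_moment[OF assms, of 0 2] prob
      by (cases "c = b") (auto simp: nn_integral_eq_integral)
    have "(\<integral>\<^sup>+x. ennreal (?n x * (x \<bullet> b)\<^sup>2) \<partial>lborel) = (\<integral>\<^sup>+x. (\<Prod>c\<in>Basis. ?f b c (x \<bullet> c)) \<partial>lborel)"
      using b by (intro nn_integral_cong)
        (simp add: prod_ennreal prod.distrib prod.delta prod_nonneg)
    also have "\<dots> = (\<Prod>c\<in>Basis. \<integral>\<^sup>+t. ?f b c t \<partial>lborel)"
      by (rule nn_integral_lborel_prod) simp_all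
    also have "\<dots> < \<infinity>"
      using fin by (auto simp: less_top[symmetric] ennreal_prod_eq_top)
    finally show "(\<integral>\<^sup>+x. ennreal (?n x * (x \<bullet> b)\<^sup>2) \<partial>lborel) < \<infinity>" .
  qed (simp_all add: prod_nonneg)
  then have "integrable lborel (\<lambda>x. \<Sum>b\<in>Basis. ?n x * (x \<bullet> b)\<^sup>2)"
    by (rule Bochner_Integration.integrable_sum)
  also have "(\<lambda>x. \<Sum>b\<in>Basis. ?n x * (x \<bullet> b)\<^sup>2) = (\<lambda>x. ?n x * (norm x)\<^sup>2)"
    unfolding power2_norm_eq_inner
    by (subst euclidean_inner) (simp add: sum_distrib_left power2_eq_square)
  finally have "integrable (gaussian \<sigma> :: 'a measure) (\<lambda>x. (norm x)\<^sup>2)"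
    unfolding gaussian_def
    by (subst integrable_density) (simp_all add: prod_nonneg)
  with ps show ?thesis
    by (simp add: P2_def gaussian_def)
qed

lemma convolution_P2:
  fixes \<mu> \<nu> :: "'a::ordered_euclidean_space measure"
  assumes "\<mu> \<in> P2" "\<nu> \<in> P2"
  shows "(\<mu> \<star> \<nu>) \<in> P2"
proof -
  note \<pi> = pair_measure_coupling[OF assms]
  interpret prob_space "\<mu> \<Otimes>\<^sub>M \<nu>" using \<pi> by (rule couplings_D)
  note [measurable] = couplings_D(5,6)[OF \<pi>]
  have "(\<mu> \<star> \<nu>) = distr (\<mu> \<Otimes>\<^sub>M \<nu>) borel (\<lambda>z. fst z + snd z)"
    by (simp add: convolution_def case_prod_unfold)
  then show ?thesis
    using couplings_integrable_add[OF assms \<pi>, of 1]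
    by (auto simp: P2_def integrable_distr_eq intro!: prob_space_distr)
qed

lemma translate_convolution:
  fixes \<mu> \<nu> :: "'a::ordered_euclidean_space measure"
  assumes "\<mu> \<in> P2" "\<nu> \<in> P2"
  shows "(translate w \<mu> \<star> \<nu>) = translate w (\<mu> \<star> \<nu>)"
proof -
  note s[measurable_cong] = P2D(2)[OF assms(1)] P2D(2)[OF assms(2)]
  interpret \<mu>: prob_space \<mu> using assms by (simp add: P2D)
  interpret \<nu>: prob_space \<nu> using assms by (simp add: P2D)
  interpret t: prob_space "translate w \<mu>" using translate_P2[OF assms(1)] by (rule P2D)
  \<comment> \<open>Writing \<nu> as its own image under the identity turns the product into a
    product of two images, to which \<open>pair_measure_distr\<close> applies.\<close>
  have "translate w \<mu> \<Otimes>\<^sub>M \<nu> = distr \<mu> borel (\<lambda>x. x + w) \<Otimes>\<^sub>M distr \<nu> borel (\<lambda>x. x)"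
    using distr_id2[OF s(2)[symmetric]] by (simp add: translate_def)
  also have "\<dots> = distr (\<mu> \<Otimes>\<^sub>M \<nu>) (borel \<Otimes>\<^sub>M borel) (\<lambda>(x, y). (x + w, y))"
    by (rule pair_measure_distr)
      (simp_all add: distr_id2[OF s(2)[symmetric]] \<nu>.sigma_finite_measure_axioms)
  finally show ?thesis
    unfolding convolution_def translate_def[of w "distr _ _ _"]
    by (simp add: distr_distr comp_def case_prod_unfold algebra_simps)
qed

lemma proj_measure_translate:
  fixes \<mu> :: "'a::euclidean_space measure"
  assumes "\<mu> \<in> P2"
  shows "proj_measure (translate w \<mu>) \<theta> = translate (\<theta> \<bullet> w) (proj_measure \<mu> \<theta>)"
proof -
  note s[measurable_cong] = P2D(2)[OF assms]
  show ?thesis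
    unfolding proj_measure_def translate_def
    by (simp add: distr_distr comp_def inner_add_right)
qed

lemma proj_measure_P2:
  fixes \<mu> :: "'a::euclidean_space measure"
  assumes "\<mu> \<in> P2"
  shows "proj_measure \<mu> \<theta> \<in> P2"
proof -
  note s[measurable_cong] = P2D(2)[OF assms]
  interpret prob_space \<mu> using assms by (rule P2D)
  have "integrable \<mu> (\<lambda>x. (norm \<theta>)\<^sup>2 * (norm x)\<^sup>2)"
    using P2D(4)[OF assms] by simp
  then have "integrable \<mu> (\<lambda>x. (\<theta> \<bullet> x)\<^sup>2)"
  proof (rule Bochner_Integration.integrable_bound)
    have "(\<theta> \<bullet> x)\<^sup>2 \<le> (norm \<theta>)\<^sup>2 * (norm x)\<^sup>2" for x
      using Cauchy_Schwarz_ineq[of \<theta> x] by (simp add: power2_norm_eq_inner)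
    then show "AE x in \<mu>. norm ((\<theta> \<bullet> x)\<^sup>2) \<le> norm ((norm \<theta>)\<^sup>2 * (norm x)\<^sup>2)" by simp
  qed measurable
  then show ?thesis
    by (auto simp: P2_def proj_measure_def integrable_distr_eq intro!: prob_space_distr)
qed

lemma integral_proj_measure:
  fixes \<mu> :: "'a::euclidean_space measure"
  assumes "\<mu> \<in> P2"
  shows "(LINT t|proj_measure \<mu> \<theta>. t) = \<theta> \<bullet> (LINT x|\<mu>. x)"
proof -
  note s[measurable_cong] = P2D(2)[OF assms]
  have "(LINT t|proj_measure \<mu> \<theta>. t) = (LINT x|\<mu>. \<theta> \<bullet> x)"
    unfolding proj_measure_def by (rule integral_distr) simp_all
  also have "\<dots> = \<theta> \<bullet> (LINT x|\<mu>. x)"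
    by (rule integral_inner_right) (rule P2D(5)[OF assms])
  finally show ?thesis .
qed

section \<open>Finiteness and second moments of the spherical measure\<close>

lemma space_sphere_measure: "space (sphere_measure :: 'a::euclidean_space measure) = sphere 0 1"
  unfolding sphere_measure_def space_scale_measure space_distr space_restrict_space by simp

lemma sets_sphere_measure:
  "sets (sphere_measure :: 'a::euclidean_space measure) = sets (restrict_space borel (sphere 0 1))"
  by (simp add: sphere_measure_def)

text \<open>The directions of the whole sphere come from the punctured unit ball, which has finite
  volume.\<close>

lemma finite_sphere_measure: "finite_measure (sphere_measure :: 'a::euclidean_space measure)"
proof
  have "emeasure lborel {x::'a. 0 < norm x \<and> norm x < 1 \<and> x /\<^sub>R norm x \<in> sphere 0 1}
      \<le> emeasure lborel (ball (0::'a) 1)"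
    by (intro emeasure_mono) auto
  also have "\<dots> < \<infinity>"
    by (rule emeasure_bounded_finite) simp
  finally show "emeasure sphere_measure (space (sphere_measure :: 'a measure)) \<noteq> \<infinity>"
    by (simp add: space_sphere_measure emeasure_sphere_measure ennreal_mult_eq_top_iff)
qed

text \<open>A continuous function is bounded on the compact sphere, and the measure is
  finite.\<close>

lemma integrable_sphere_measure:
  fixes f :: "'a::euclidean_space \<Rightarrow> 'b::{banach, second_countable_topology}"
  assumes "continuous_on UNIV f"
  shows "integrable sphere_measure f"
proof -
  interpret finite_measure "sphere_measure :: 'a measure" by (rule finite_sphere_measure)
  have "compact (f ` sphere 0 1)"
    by (intro compact_continuous_image continuous_on_subset[OF assms]) auto
  then obtain B where B: "\<And>x. x \<in> sphere 0 1 \<Longrightarrow> norm (f x) \<le> B"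
    using compact_imp_bounded bounded_iff by (metis imageI)
  show ?thesis
  proof (rule integrable_const_bound)
    show "AE x in sphere_measure. norm (f x) \<le> B"
      by (rule AE_I2) (simp add: space_sphere_measure B)
    show "f \<in> borel_measurable sphere_measure"
      unfolding measurable_cong_sets[OF sets_sphere_measure refl]
      by (intro measurable_restrict_space1 borel_measurable_continuous_onI assms)
  qed
qed

text \<open>The second-moment matrix of the spherical measure, the integral of \<theta> times its
  transpose, encoded as the map h \<mapsto> (matrix applied to h).\<close>

definition sphere_second_moment :: "'a::euclidean_space \<Rightarrow> 'a" where
  "sphere_second_moment h = (LINT \<theta>|sphere_measure. (\<theta> \<bullet> h) *\<^sub>R \<theta>)"

lemma integrable_second_moment: "integrable sphere_measure (\<lambda>\<theta>. (\<theta> \<bullet> h) *\<^sub>R \<theta>)"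
  by (intro integrable_sphere_measure continuous_intros)

lemma linear_sphere_second_moment: "linear sphere_second_moment"
proof
  show "sphere_second_moment (x + y) = sphere_second_moment x + sphere_second_moment y" for x y :: 'a
    unfolding sphere_second_moment_def inner_add_right scaleR_left_distrib
    by (intro Bochner_Integration.integral_add integrable_second_moment)
  show "sphere_second_moment (c *\<^sub>R x) = c *\<^sub>R sphere_second_moment x" for c and x :: 'a
    unfolding sphere_second_moment_def by (simp flip: integral_scaleR_right)
qed

text \<open>Rewrites the integrals over directions as a bilinear form. Its right side is symmetric
  in w and h, so the operator is self-adjoint.\<close>

lemma inner_sphere_second_moment:
  "w \<bullet> sphere_second_moment h = (LINT \<theta>|sphere_measure. (\<theta> \<bullet> w) * (\<theta> \<bullet> h))"
  unfolding sphere_second_moment_def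
  by (subst integral_inner_right[symmetric, OF integrable_second_moment])
    (simp add: inner_commute mult.commute)

section \<open>The Hessian of a quadratic polynomial\<close>

lemma has_hessian_quadratic:
  fixes S :: "real ^ 'n \<Rightarrow> real ^ 'n"
  assumes "linear S" and sym: "\<And>x y. x \<bullet> S y = y \<bullet> S x"
  shows "has_hessian (\<lambda>w. c + 2 * (w \<bullet> b) + w \<bullet> S w) (matrix (\<lambda>h. 2 *\<^sub>R S h)) x"
proof -
  have lin: "linear (\<lambda>h. 2 *\<^sub>R S h)"
    using assms(1) by (rule linear_compose_scale_right)
  have bl: "bounded_linear S" "bounded_linear (\<lambda>h. 2 *\<^sub>R S h)"
    using assms(1) lin by (simp_all add: linear_conv_bounded_linear)
  note bounded_linear.has_derivative[OF bl(1), derivative_intros]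
  \<comment> \<open>The product rule gives h \<bullet> S y + y \<bullet> S h, and symmetry of S
    merges these into 2 (h \<bullet> S y). The gradient is affine in y, hence the Hessian is
    constant.\<close>
  have "GDERIV (\<lambda>w. c + 2 * (w \<bullet> b) + w \<bullet> S w) y :> 2 *\<^sub>R b + 2 *\<^sub>R S y" for y
    unfolding gderiv_def
    by (rule derivative_eq_intros refl)+ (simp add: fun_eq_iff sym algebra_simps inner_commute)
  moreover have "((\<lambda>y. 2 *\<^sub>R b + 2 *\<^sub>R S y) has_derivative (\<lambda>h. matrix (\<lambda>h. 2 *\<^sub>R S h) *v h)) (at x)"
    by (rule derivative_eq_intros refl)+ (simp add: fun_eq_iff matrix_works lin)
  ultimately show ?thesis
    unfolding has_hessian_def by (intro exI[of _ "\<lambda>y. 2 *\<^sub>R b + 2 *\<^sub>R S y"]) simp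
qed

section \<open>The squared sliced distance as a function of the translation\<close>

lemma wasserstein2_proj_translate:
  fixes \<mu> \<nu> :: "'a::euclidean_space measure"
  assumes "\<mu> \<in> P2" "\<nu> \<in> P2"
  shows "(wasserstein2 (proj_measure (translate w \<mu>) \<theta>) (proj_measure \<nu> \<theta>))\<^sup>2
    = (wasserstein2 (proj_measure \<mu> \<theta>) (proj_measure \<nu> \<theta>))\<^sup>2
      + (2 * ((\<theta> \<bullet> w) * (\<theta> \<bullet> ((LINT x|\<mu>. x) - (LINT x|\<nu>. x)))) + (\<theta> \<bullet> w) * (\<theta> \<bullet> w))"
  using wasserstein2_translate[OF proj_measure_P2[OF assms(1)] proj_measure_P2[OF assms(2)]]
  by (simp add: proj_measure_translate integral_proj_measure assms inner_diff_right power2_eq_square)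

lemma integrable_inner_products:
  "integrable sphere_measure (\<lambda>\<theta>. (\<theta> \<bullet> x) * (\<theta> \<bullet> y))"
  by (intro integrable_sphere_measure continuous_intros)

text \<open>Valid for arbitrary measures: the integral of a square is non-negative, also when it is
  0 by default for want of integrability.\<close>

lemma SW2_sq:
  "(SW2 \<mu> \<nu>)\<^sup>2 = (LINT \<theta>|sphere_measure. (wasserstein2 (proj_measure \<mu> \<theta>) (proj_measure \<nu> \<theta>))\<^sup>2)"
  unfolding SW2_def by (intro real_sqrt_pow2 integral_nonneg_AE) simp

text \<open>Integrates the projected translation formula over \<theta>. The linear and the quadratic
  term in w become inner products with the same operator; \<mu> and \<nu> enter the linear term
  through their means and the quadratic term not at all.\<close>

lemma SW2_translate:
  fixes \<mu> \<nu> :: "'a::euclidean_space measure"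
  assumes "\<mu> \<in> P2" "\<nu> \<in> P2"
    and int: "integrable sphere_measure (\<lambda>\<theta>. (wasserstein2 (proj_measure \<mu> \<theta>) (proj_measure \<nu> \<theta>))\<^sup>2)"
  shows "(SW2 (translate w \<mu>) \<nu>)\<^sup>2 = (SW2 \<mu> \<nu>)\<^sup>2
    + 2 * (w \<bullet> sphere_second_moment ((LINT x|\<mu>. x) - (LINT x|\<nu>. x))) + w \<bullet> sphere_second_moment w"
  unfolding SW2_sq wasserstein2_proj_translate[OF assms(1,2)] inner_sphere_second_moment
  by (simp only: Bochner_Integration.integral_add[OF int] Bochner_Integration.integral_add
      Bochner_Integration.integrable_add integrable_mult_right integrable_inner_products
      integral_mult_right_zero add.assoc)

text \<open>A Bochner integral of a non-integrable function is 0, and translating \<open>\<mu>\<close> does not affect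
  integrability, so no measurability in \<open>\<theta>\<close> of the Wasserstein distance is needed.\<close>

lemma SW2_translate_not_integrable:
  fixes \<mu> \<nu> :: "'a::euclidean_space measure"
  assumes "\<mu> \<in> P2" "\<nu> \<in> P2"
    and "\<not> integrable sphere_measure (\<lambda>\<theta>. (wasserstein2 (proj_measure \<mu> \<theta>) (proj_measure \<nu> \<theta>))\<^sup>2)"
  shows "(SW2 (translate w \<mu>) \<nu>)\<^sup>2 = 0"
proof -
  let ?g = "\<lambda>\<theta>. 2 * ((\<theta> \<bullet> w) * (\<theta> \<bullet> ((LINT x|\<mu>. x) - (LINT x|\<nu>. x)))) + (\<theta> \<bullet> w) * (\<theta> \<bullet> w)"
  have g: "integrable sphere_measure ?g"
    by (intro integrable_sphere_measure continuous_intros)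
  have "\<not> integrable sphere_measure
      (\<lambda>\<theta>. (wasserstein2 (proj_measure \<mu> \<theta>) (proj_measure \<nu> \<theta>))\<^sup>2 + ?g \<theta>)"
  proof
    assume "integrable sphere_measure
      (\<lambda>\<theta>. (wasserstein2 (proj_measure \<mu> \<theta>) (proj_measure \<nu> \<theta>))\<^sup>2 + ?g \<theta>)"
    from Bochner_Integration.integrable_diff[OF this g] show False
      using assms(3) by (simp only: add_diff_cancel_right')
  qed
  then show ?thesis
    unfolding SW2_sq wasserstein2_proj_translate[OF assms(1,2)]
    by (rule not_integrable_integral_eq)
qed

theorem lemma4p7:
  shows "\<exists>C>0. \<forall>\<nu>\<in>(P2 :: (real ^ 'n) measure set). \<forall>\<sigma>>0. \<forall>\<mu>\<in>P2.
    calH_exists (\<lambda>\<mu>'. (SW2_reg \<sigma> \<mu>' \<nu>)\<^sup>2) \<mu> \<and>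
    norm (calH (\<lambda>\<mu>'. (SW2_reg \<sigma> \<mu>' \<nu>)\<^sup>2) \<mu>) \<le> C"
proof -
  let ?S = "sphere_second_moment :: real ^ 'n \<Rightarrow> real ^ 'n"
  \<comment> \<open>The common Hessian, fixed before \<mu>, \<nu> and \<sigma> are introduced. The
    constant will be its norm plus 1, where the 1 ensures strict positivity.\<close>
  let ?A = "matrix (\<lambda>h. 2 *\<^sub>R ?S h)"
  have sym: "x \<bullet> ?S y = y \<bullet> ?S x" for x y
    by (simp add: inner_sphere_second_moment mult.commute)
  have "calH_exists (\<lambda>\<mu>'. (SW2_reg \<sigma> \<mu>' \<nu>)\<^sup>2) \<mu> \<and>
      norm (calH (\<lambda>\<mu>'. (SW2_reg \<sigma> \<mu>' \<nu>)\<^sup>2) \<mu>) \<le> norm ?A + 1"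
    if \<nu>: "\<nu> \<in> P2" and \<sigma>: "\<sigma> > 0" and \<mu>: "\<mu> \<in> P2" for \<nu> \<mu> :: "(real ^ 'n) measure" and \<sigma>
  proof -
    let ?F = "\<lambda>w. (SW2_reg \<sigma> (translate w \<mu>) \<nu>)\<^sup>2"
    let ?\<mu> = "\<mu> \<star> gaussian \<sigma>" and ?\<nu> = "\<nu> \<star> gaussian \<sigma>"
    note P2 = convolution_P2[OF \<mu> gaussian_P2[OF \<sigma>]] convolution_P2[OF \<nu> gaussian_P2[OF \<sigma>]]
    \<comment> \<open>The translation is moved past the smoothing, so the formulas for
      \<open>SW2\<close> apply to the smoothed measures.\<close>
    have F: "?F = (\<lambda>w. (SW2 (translate w ?\<mu>) ?\<nu>)\<^sup>2)"
      by (simp add: SW2_reg_def translate_convolution[OF \<mu> gaussian_P2[OF \<sigma>]])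
    have "\<exists>A. has_hessian ?F A 0 \<and> norm A \<le> norm ?A + 1"
    proof (cases "integrable sphere_measure
        (\<lambda>\<theta>. (wasserstein2 (proj_measure ?\<mu> \<theta>) (proj_measure ?\<nu> \<theta>))\<^sup>2)")
      case True
      have "has_hessian ?F ?A 0"
        unfolding F SW2_translate[OF P2 True]
        by (rule has_hessian_quadratic[OF linear_sphere_second_moment sym])
      then show ?thesis by (intro exI[of _ ?A]) simp
    \<comment> \<open>In the other case \<open>?F\<close> vanishes identically by the default value
      of the integral, and its Hessian is the zero matrix.\<close>
    next
      case False
      have "(*v) (0 :: real ^ 'n ^ 'n) = (\<lambda>_. 0)"
        by (simp add: fun_eq_iff)
      then have "has_hessian (\<lambda>w::real ^ 'n. 0) 0 0"
        unfolding has_hessian_def by (intro exI[of _ "\<lambda>_. 0"]) (simp add: GDERIV_const)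
      then show ?thesis
        unfolding F SW2_translate_not_integrable[OF P2 False] by (intro exI[of _ 0]) simp
    qed
    \<comment> \<open>Existence of the Hessian is immediate; its uniqueness, through
      \<open>hessian_eq\<close>, identifies \<open>calH\<close> with the matrix just
      bounded.\<close>
    then show ?thesis
      by (auto simp: calH_exists_def calH_def twice_differentiable_at_def hessian_eq)
  qed
  then show ?thesis
    by (intro exI[of _ "norm ?A + 1"]) (auto intro: add_nonneg_pos)
qed

end
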